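(* Suppose that $p\in C^1[0,+\infty)$, $\int_0^1\frac{p(\rho)}{\rho^2}d\rho<+\infty$, $\lim_{\rho\to\infty}\frac{p(\rho)}{\rho^\gamma}=K$, $p(\rho)\ge0$, and $p'(\rho)>0$ for $\rho>0$, where $0<K<+\infty$ and $\gamma\ge4/3$ are constants, and that $$\lim_{\rho\to0+}\frac{p(\rho)}{\rho^{\gamma_1}}=\beta$$ for some constants $\gamma_1>4/3$ and $0<\beta<+\infty$. Then there exists $\mathbb M_c$, with $0<\mathbb M_c<+\infty$ if $\gamma=4/3$ and $\mathbb M_c=+\infty$ if $\gamma>4/3$, such that if $0<M<\mathbb M_c$ and $L\in C^1[0,M]$ satisfies $L(0)=0$ and $L(m)\ge0$ for $0\le m\le M$, then $$\inf_{\rho\in W_M}F(\rho)<0.$$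
   Context: Here $\int=\int_{\mathbb R^3}$, and for $x\in\mathbb R^3$, $r(x)=\sqrt{x_1^2+x_2^2}$. A function on $\mathbb R^3$ is axisymmetric if it depends only on $(r(x),x_3)$. $Bf(x)=\int\frac{f(y)}{|x-y|}dy$; $m_\rho(r)=\int_{\{r(x)<r\}}\rho(x)\,dx$; $A(\rho)=\rho\int_0^\rho\frac{p(s)}{s^2}ds$. $L$ is the square of the angular momentum per unit mass. For $M>0$, $$W_M=\Big\{\rho:\mathbb R^3\to\mathbb R:\ \rho\text{ axisymmetric},\ \rho\ge0\text{ a.e.},\ \int\rho\,dx=M,\ \int\Big(A(\rho(x))+\frac{\rho(x)L(m_\rho(r(x)))}{r(x)^2}+\rho(x)B\rho(x)\Big)dx<+\infty\Big\},$$ $$F(\rho)=\int\Big[A(\rho(x))+\frac12\frac{\rho(x)L(m_\rho(r(x)))}{r(x)^2}-\frac12\rho(x)B\rho(x)\Big]dx,\qquad\rho\in W_M.$$ *)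

theory Defs
  imports "HOL-Analysis.Analysis"
begin

text \<open>
  One-sided derivatives are used at boundary points of \<open>S\<close>, so that for \<open>S = {0..}\<close> and
  \<open>S = {0..M}\<close> only the values of \<open>f\<close> on \<open>S\<close> matter. (The library's
  \<open>C1_differentiable_on\<close> asks for two-sided derivatives at every point of \<open>S\<close>.)
\<close>
definition C1_on :: "real set \<Rightarrow> (real \<Rightarrow> real) \<Rightarrow> bool" where
  "C1_on S f \<longleftrightarrow>
     (\<exists>f'. (\<forall>x\<in>S. (f has_real_derivative f' x) (at x within S)) \<and> continuous_on S f')"

definition rad :: "real^3 \<Rightarrow> real" where
  "rad x = sqrt ((x$1)\<^sup>2 + (x$2)\<^sup>2)"

definition axisymmetric :: "(real^3 \<Rightarrow> real) \<Rightarrow> bool" where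
  "axisymmetric f \<longleftrightarrow> (\<exists>g. \<forall>x. f x = g (rad x) (x$3))"

text \<open>
  For Lebesgue-integrable \<open>f\<close> the integral converges for almost every \<open>x\<close>; the value 0
  that the Bochner integral takes at the remaining points does not affect the integrals below.
\<close>
definition newton_pot :: "(real^3 \<Rightarrow> real) \<Rightarrow> real^3 \<Rightarrow> real" where
  "newton_pot f x = (LINT y|lebesgue. f y / norm (x - y))"

definition cyl_mass :: "(real^3 \<Rightarrow> real) \<Rightarrow> real \<Rightarrow> real" where
  "cyl_mass \<rho> r = (LINT x:{x. rad x < r}|lebesgue. \<rho> x)"

definition A_fun :: "(real \<Rightarrow> real) \<Rightarrow> real \<Rightarrow> real" where
  "A_fun p \<rho> = \<rho> * (LINT s:{0<..\<rho>}|lborel. p s / s\<^sup>2)"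

text \<open>
  The three summands in the last condition are nonnegative almost everywhere when \<open>p\<close> is
  nonnegative on \<open>{0..}\<close> and \<open>L\<close> on \<open>{0..M}\<close>, because \<open>cyl_mass \<rho> r\<close> lies in \<open>{0..M}\<close>; so
  integrability says exactly that the integral is less than \<open>+\<infinity>\<close>. On the axis, a null set,
  the division by \<open>(rad x)\<^sup>2 = 0\<close> gives 0.
\<close>
definition W :: "(real \<Rightarrow> real) \<Rightarrow> (real \<Rightarrow> real) \<Rightarrow> real \<Rightarrow> (real^3 \<Rightarrow> real) set" where
  "W p L M = {\<rho>. axisymmetric \<rho> \<and> (AE x in lebesgue. \<rho> x \<ge> 0) \<and>
     integrable lebesgue \<rho> \<and> (LINT x|lebesgue. \<rho> x) = M \<and>
     integrable lebesgue (\<lambda>x. A_fun p (\<rho> x) + \<rho> x * L (cyl_mass \<rho> (rad x)) / (rad x)\<^sup>2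
                              + \<rho> x * newton_pot \<rho> x)}"

definition F :: "(real \<Rightarrow> real) \<Rightarrow> (real \<Rightarrow> real) \<Rightarrow> (real^3 \<Rightarrow> real) \<Rightarrow> real" where
  "F p L \<rho> = (LINT x|lebesgue. A_fun p (\<rho> x)
                 + 1/2 * (\<rho> x * L (cyl_mass \<rho> (rad x)) / (rad x)\<^sup>2)
                 - 1/2 * (\<rho> x * newton_pot \<rho> x))"

end

theory Submission
  imports Defs
begin

text \<open>
  Spread the mass uniformly over the ball of radius \<open>R\<close> with large \<open>R\<close>, so the density \<open>a\<close> is of
  order \<open>1/R\<^sup>3\<close>. The internal energy is then at most of order \<open>a powr (\<gamma>\<^sub>1 - 1)\<close>, that is
  \<open>R powr (-3 * (\<gamma>\<^sub>1 - 1))\<close>, where \<open>3 * (\<gamma>\<^sub>1 - 1) > 1\<close>. Since \<open>L m \<le> C * m\<close> and the mass inside a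
  cylinder of radius \<open>r\<close> is at most \<open>8 * a * r\<^sup>2 * R\<close>, the rotational energy is of order
  \<open>1/R\<^sup>2\<close>. The gravitational energy is at least \<open>M\<^sup>2 / (4 * R)\<close> and so wins, whatever \<open>M\<close> is.
\<close>

section \<open>Preliminary bounds for the Newtonian kernel and for \<open>L\<close>\<close>

text \<open>In the shell 2^-(m+1) \<le> |z| < 2^-m the single term n = m already dominates 1/|z|;
  the summand 1 covers |z| \<ge> 1. At z = 0 the left side is 0 by the division convention. The
  right side integrates through ball volumes alone, without polar coordinates.\<close>

lemma inverse_norm_le_dyadic:
  fixes z :: "'a::real_normed_vector"
  shows "ennreal (1 / norm z) \<le> 1 + (\<Sum>n. ennreal (2 ^ Suc n) * indicator (ball 0 ((1/2) ^ n)) z)"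
proof (cases "norm z \<ge> 1 \<or> z = 0")
  case True
  then have "1 / norm z \<le> 1" by (auto simp: divide_simps)
  then show ?thesis
    by (metis add_increasing2 ennreal_le_1 zero_le)
next
  case False
  then have z: "0 < norm z" "norm z < 1" by auto
  obtain k where k: "(1/2::real) ^ k < norm z"
    using real_arch_pow_inv[of "norm z" "1/2"] z by auto
  \<comment> \<open>Minimality of \<open>n\<close> places z in the dyadic shell between (1/2)^n and
    (1/2)^(n-1).\<close>
  define n where "n = (LEAST k. (1/2::real) ^ k \<le> norm z)"
  have n: "(1/2::real) ^ n \<le> norm z"
    unfolding n_def by (rule LeastI[of _ k]) (use k in simp)
  have "n \<noteq> 0" using n z by (cases n) auto
  then obtain m where m: "n = Suc m" by (cases n) auto
  have "\<not> (1/2::real) ^ m \<le> norm z"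
    using not_less_Least[of m "\<lambda>k. (1/2::real) ^ k \<le> norm z"] m unfolding n_def by simp
  then have mem: "z \<in> ball 0 ((1/2) ^ m)" by simp
  have "1 / norm z \<le> 2 ^ Suc m"
    using n z m by (simp add: divide_simps mult.commute)
  then have "ennreal (1 / norm z) \<le> ennreal (2 ^ Suc m) * indicator (ball 0 ((1/2) ^ m)) z"
    using mem by (simp add: ennreal_leI)
  also have "\<dots> \<le> (\<Sum>n. ennreal (2 ^ Suc n) * indicator (ball 0 ((1/2) ^ n)) z)"
    using sum_le_suminf[OF summableI, of "{m}" "\<lambda>n. ennreal (2 ^ Suc n) * indicator (ball 0 ((1/2) ^ n)) z"]
    by (simp del: sum_mult_indicator)
  finally show ?thesis by (meson add_increasing order_trans zero_le)
qed

lemma sets_borel_ball [measurable]: "ball x r \<in> sets borel"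
  by simp

text \<open>Termwise integration of the dyadic bound: with V the unit ball volume, the n-th ball
  contributes 2^(n+1) * V * 8^-n = 2V * 4^-n, and these sum to 8V/3. The bound is uniform in
  \<open>x\<close>, which makes the potential bounded.\<close>

lemma nn_integral_newton_kernel_le:
  fixes x :: "real^3"
  assumes [measurable]: "S \<in> sets borel"
  shows "(\<integral>\<^sup>+y. indicator S y * ennreal (1 / norm (x - y)) \<partial>lborel)
    \<le> emeasure lborel S + ennreal (8/3 * unit_ball_vol 3)"
proof -
  let ?g = "\<lambda>n y. ennreal (2 ^ Suc n) * indicator (ball x ((1/2) ^ n)) y"
  have "(\<integral>\<^sup>+y. indicator S y * ennreal (1 / norm (x - y)) \<partial>lborel)
      \<le> (\<integral>\<^sup>+y. indicator S y + (\<Sum>n. ?g n y) \<partial>lborel)"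
  proof (rule nn_integral_mono)
    fix y :: "real^3"
    have *: "indicator (ball 0 ((1/2) ^ n)) (x - y) = (indicator (ball x ((1/2) ^ n)) y :: ennreal)" for n
      by (auto simp: indicator_def dist_norm norm_minus_commute)
    show "indicator S y * ennreal (1 / norm (x - y)) \<le> indicator S y + (\<Sum>n. ?g n y)"
      using inverse_norm_le_dyadic[of "x - y"] unfolding * by (auto simp: indicator_def)
  qed
  also have "\<dots> = emeasure lborel S + (\<Sum>n. \<integral>\<^sup>+y. ?g n y \<partial>lborel)"
  proof (subst nn_integral_add)
    show "(\<integral>\<^sup>+y. indicator S y \<partial>lborel) + (\<integral>\<^sup>+y. (\<Sum>n. ?g n y) \<partial>lborel)
        = emeasure lborel S + (\<Sum>n. \<integral>\<^sup>+y. ?g n y \<partial>lborel)"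
      by (subst nn_integral_suminf) (auto intro!: borel_measurable_times borel_measurable_indicator)
  qed measurable
  also have "(\<lambda>n. \<integral>\<^sup>+y. ?g n y \<partial>lborel) = (\<lambda>n. ennreal (2 * unit_ball_vol 3 * (1/4) ^ n))"
  proof
    fix n
    have "2 ^ Suc n * (unit_ball_vol 3 * ((1/2::real) ^ n) ^ 3) = 2 * unit_ball_vol 3 * (2 * (1/2) ^ 3) ^ n"
      unfolding power_mult_distrib power_mult[symmetric] by (simp add: mult.commute)
    also have "\<dots> = 2 * unit_ball_vol 3 * (1/4) ^ n" by (simp add: power3_eq_cube)
    finally have eq: "2 ^ Suc n * (unit_ball_vol 3 * ((1/2::real) ^ n) ^ 3) = 2 * unit_ball_vol 3 * (1/4) ^ n" .
    have "(\<integral>\<^sup>+y. ?g n y \<partial>lborel) = ennreal (2 ^ Suc n) * emeasure lborel (ball x ((1/2) ^ n))"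
      by (subst nn_integral_cmult) auto
    also have "\<dots> = ennreal (2 ^ Suc n) * ennreal (unit_ball_vol 3 * ((1/2::real) ^ n) ^ 3)"
      by (subst emeasure_ball) auto
    also have "\<dots> = ennreal (2 * unit_ball_vol 3 * (1/4) ^ n)"
      unfolding eq[symmetric] by (subst ennreal_mult) auto
    finally show "(\<integral>\<^sup>+y. ?g n y \<partial>lborel) = ennreal (2 * unit_ball_vol 3 * (1/4) ^ n)" .
  qed
  also have "(\<Sum>n. ennreal (2 * unit_ball_vol 3 * (1/4) ^ n)) = ennreal (8/3 * unit_ball_vol 3)"
  proof (rule suminf_ennreal_eq)
    show "(\<lambda>n. 2 * unit_ball_vol 3 * (1/4::real) ^ n) sums (8/3 * unit_ball_vol 3)"
      using sums_mult[OF geometric_sums[of "1/4::real"], of "2 * unit_ball_vol 3"] by simp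
  qed simp
  finally show ?thesis by (simp add: add_left_mono)
qed

text \<open>Mean value inequality with a derivative bounded by compactness. Linear growth turns the
  r^2 smallness of the mass in a thin cylinder into control of L/r^2 near the axis.\<close>

lemma C1_on_linear_bound:
  assumes "C1_on {0..M} L" "L 0 = 0"
  obtains C where "C > 0" "\<And>m. m \<in> {0..M} \<Longrightarrow> L m \<le> C * m"
proof -
  obtain L' where L': "\<And>x. x \<in> {0..M} \<Longrightarrow> (L has_real_derivative L' x) (at x within {0..M})"
    and cont: "continuous_on {0..M} L'"
    using assms(1) unfolding C1_on_def by blast
  have "bounded (L' ` {0..M})"
    by (intro compact_imp_bounded compact_continuous_image cont) simp
  then obtain C where C: "C > 0" "\<And>x. x \<in> {0..M} \<Longrightarrow> norm (L' x) \<le> C"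
    by (force simp: bounded_pos)
  have "L m \<le> C * m" if "m \<in> {0..M}" for m
    using field_differentiable_bound[of "{0..M}" L L' C m 0] L' C that assms(2) by auto
  with C that show thesis by blast
qed


section \<open>Newtonian potentials of multiples of indicator functions\<close>

text \<open>A lower bound on the potential needs this: a non-integrable integrand would give the
  Bochner integral its default value 0.\<close>

lemma integrable_newton_kernel:
  fixes x :: "real^3"
  assumes [measurable]: "S \<in> sets borel" and fin: "emeasure lborel S < \<infinity>"
  shows "integrable lborel (\<lambda>y. indicator S y / norm (x - y) :: real)"
proof (rule integrableI_bounded)
  have "(\<integral>\<^sup>+y. ennreal (norm (indicator S y / norm (x - y) :: real)) \<partial>lborel)
      = (\<integral>\<^sup>+y. indicator S y * ennreal (1 / norm (x - y)) \<partial>lborel)"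
    by (intro nn_integral_cong) (auto simp: indicator_def)
  also have "\<dots> < \<infinity>"
    using nn_integral_newton_kernel_le[OF assms(1), of x] fin by (simp add: order_le_less_trans)
  finally show "(\<integral>\<^sup>+y. ennreal (norm (indicator S y / norm (x - y) :: real)) \<partial>lborel) < \<infinity>" .
qed simp

lemma newton_pot_eq_lborel:
  assumes [measurable]: "f \<in> borel_measurable borel"
  shows "newton_pot f x = (LINT y|lborel. f y / norm (x - y))"
  unfolding newton_pot_def by (rule integral_completion) measurable

lemma borel_measurable_newton_pot:
  assumes [measurable]: "f \<in> borel_measurable borel"
  shows "newton_pot f \<in> borel_measurable borel"
proof -
  have "newton_pot f = (\<lambda>x. LINT y|lborel. f y / norm (x - y))"
    by (rule ext) (rule newton_pot_eq_lborel[OF assms])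
  also have "\<dots> \<in> borel_measurable borel" by measurable
  finally show ?thesis .
qed

lemma newton_pot_indicator_nonneg: "a \<ge> 0 \<Longrightarrow> newton_pot (\<lambda>y. a * indicator S y) x \<ge> 0"
  unfolding newton_pot_def by (intro integral_nonneg_AE) auto

text \<open>Serves integrability of the potential energy density, hence membership in
  \<open>W\<close>; there the bound need only be finite and uniform in \<open>x\<close>.\<close>

lemma newton_pot_indicator_le:
  assumes [measurable]: "S \<in> sets borel" and fin: "emeasure lborel S < \<infinity>" and "a \<ge> 0"
  shows "newton_pot (\<lambda>y. a * indicator S y) x \<le> a * (measure lborel S + 8/3 * unit_ball_vol 3)"
proof -
  have "(LINT y|lborel. indicator S y / norm (x - y))
      \<le> measure lborel S + 8/3 * unit_ball_vol 3"
  proof (rule integral_real_bounded)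
    have "(\<integral>\<^sup>+y. ennreal (indicator S y / norm (x - y) :: real) \<partial>lborel)
        = (\<integral>\<^sup>+y. indicator S y * ennreal (1 / norm (x - y)) \<partial>lborel)"
      by (intro nn_integral_cong) (auto simp: indicator_def)
    also have "\<dots> \<le> emeasure lborel S + ennreal (8/3 * unit_ball_vol 3)"
      by (rule nn_integral_newton_kernel_le) simp
    also have "\<dots> = ennreal (measure lborel S + 8/3 * unit_ball_vol 3)"
      using fin by (simp add: emeasure_eq_ennreal_measure ennreal_plus)
    finally show "(\<integral>\<^sup>+y. ennreal (indicator S y / norm (x - y) :: real) \<partial>lborel)
        \<le> ennreal (measure lborel S + 8/3 * unit_ball_vol 3)" .
  qed simp
  then show ?thesis
    using \<open>a \<ge> 0\<close> by (subst newton_pot_eq_lborel) (auto simp: mult_left_mono simp flip: times_divide_eq_right)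
qed

lemma newton_pot_indicator_ge:
  assumes [measurable]: "S \<in> sets borel" and fin: "emeasure lborel S < \<infinity>" and "a \<ge> 0"
    and D: "D > 0" "\<And>y. y \<in> S \<Longrightarrow> dist x y \<le> D"
  shows "newton_pot (\<lambda>y. a * indicator S y) x \<ge> a * measure lborel S / D"
proof -
  have "(LINT y|lborel. indicator S y / D) \<le> (LINT y|lborel. indicator S y / norm (x - y))"
  proof (rule integral_mono_AE)
    show "integrable lborel (\<lambda>y. indicator S y / D)"
      using fin by (intro integrable_divide integrable_real_indicator) auto
    show "AE y in lborel. indicator S y / D \<le> indicator S y / norm (x - y)"
      \<comment> \<open>The point y = x is excluded because division by zero makes the right side 0
        there.\<close>
      using AE_lborel_singleton[of x]
      by eventually_elim (use D in \<open>auto simp: indicator_def dist_norm intro!: divide_left_mono mult_pos_pos\<close>)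
  qed (use integrable_newton_kernel[OF assms(1) fin] in simp)
  then show ?thesis
    using \<open>a \<ge> 0\<close>
    by (subst newton_pot_eq_lborel)
      (auto simp: mult_left_mono simp flip: times_divide_eq_right)
qed

section \<open>Cylinders, and integrals of functions supported on sets of finite volume\<close>

lemma borel_measurable_rad [measurable]: "rad \<in> borel_measurable borel"
  unfolding rad_def by measurable

lemma norm_eq_rad: "norm x = sqrt ((rad x)\<^sup>2 + (x$3)\<^sup>2)"
  by (simp add: norm_vec_def L2_set_def sum_3 rad_def)

text \<open>The set lies in a box with half-widths r, r, R. The factor r^2 is what matters: it
  cancels the 1/r^2 of the rotational energy.\<close>

lemma measure_cylinder_Int_ball_le:
  assumes "r \<ge> 0" "R \<ge> 0"
  shows "measure lborel ({x. rad x < r} \<inter> ball 0 R) \<le> 8 * r\<^sup>2 * R"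
proof -
  let ?u = "vector [r, r, R] :: real^3"
  have "x \<in> cbox (- ?u) ?u" if "x \<in> {x. rad x < r} \<inter> ball 0 R" for x
  proof -
    have "\<bar>x$1\<bar> \<le> rad x" "\<bar>x$2\<bar> \<le> rad x"
      unfolding rad_def by (auto intro!: real_le_rsqrt)
    moreover have "\<bar>x$3\<bar> \<le> norm x" by (rule component_le_norm_cart)
    ultimately show ?thesis
      using that by (auto simp: mem_box_cart forall_3 abs_le_iff)
  qed
  then have "measure lborel ({x. rad x < r} \<inter> ball 0 R) \<le> measure lborel (cbox (- ?u) ?u)"
    by (intro measure_mono_fmeasurable) auto
  also have "\<dots> = (\<Prod>i\<in>UNIV. ?u $ i - (- ?u) $ i)"
    using assms by (intro content_cbox_cart) (simp add: interval_ne_empty_cart forall_3)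
  also have "\<dots> = 8 * r\<^sup>2 * R"
    unfolding UNIV_3 by (simp add: power2_eq_square)
  finally show ?thesis .
qed

lemma cyl_mass_indicator:
  assumes [measurable]: "S \<in> sets borel"
  shows "cyl_mass (\<lambda>x. a * indicator S x) r = a * measure lborel ({x. rad x < r} \<inter> S)"
proof -
  have "cyl_mass (\<lambda>x. a * indicator S x) r = (LINT x|lborel. a * indicator ({x. rad x < r} \<inter> S) x)"
    unfolding cyl_mass_def set_lebesgue_integral_def
    by (subst integral_completion) (auto simp: indicator_inter_arith mult_ac)
  then show ?thesis by simp
qed

text \<open>Rests on \<open>A_fun p 0 = 0\<close>: vacuum carries no internal energy.\<close>

lemma A_fun_indicator: "A_fun p (a * indicator S x) = A_fun p a * indicator S x"
  by (simp add: A_fun_def indicator_def)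

lemma integrable_lebesgue_bounded_on:
  fixes f :: "'a::euclidean_space \<Rightarrow> real"
  assumes [measurable]: "f \<in> borel_measurable borel" "S \<in> sets borel"
    and fin: "emeasure lborel S < \<infinity>" and f: "\<And>x. \<bar>f x\<bar> \<le> B * indicator S x"
  shows "integrable lebesgue f" "\<bar>LINT x|lebesgue. f x\<bar> \<le> B * measure lborel S"
proof -
  have int: "integrable lborel (\<lambda>x. B * indicator S x :: real)" using fin by simp
  then have i: "integrable lborel f"
    by (rule Bochner_Integration.integrable_bound) (use f in \<open>auto intro: order_trans[OF _ abs_ge_self]\<close>)
  then show "integrable lebesgue f" by (simp add: integrable_completion)
  have "\<bar>LINT x|lborel. f x\<bar> \<le> (LINT x|lborel. B * indicator S x)"
    using Bochner_Integration.integral_norm_bound_integral[OF i int] f by simp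
  then show "\<bar>LINT x|lebesgue. f x\<bar> \<le> B * measure lborel S"
    by (simp add: integral_completion)
qed


section \<open>The uniform ball as trial density, and its energy\<close>

locale uniform_ball =
  fixes R M a :: real
  assumes R: "R > 0" and M: "M > 0" and a_eq: "a = M / (unit_ball_vol 3 * R ^ 3)"
begin

definition \<rho> :: "real^3 \<Rightarrow> real" where "\<rho> = (\<lambda>x. a * indicator (ball 0 R) x)"

lemma a_pos: "a > 0"
  using R M by (simp add: a_eq)

lemma mass: "a * measure lborel (ball (0::real^3) R) = M"
  using R less_imp_neq[OF unit_ball_vol_pos[of 3]] by (simp add: content_ball a_eq)

lemma ball_finite: "emeasure lborel (ball (0::real^3) R) < \<infinity>"
  using R by (subst emeasure_ball) auto

lemma measurable_\<rho> [measurable]: "\<rho> \<in> borel_measurable borel"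
  unfolding \<rho>_def by measurable

lemma axisymmetric_\<rho>: "axisymmetric \<rho>"
  unfolding axisymmetric_def
  by (rule exI[of _ "\<lambda>r z. a * indicator {..<R} (sqrt (r\<^sup>2 + z\<^sup>2))"])
    (auto simp: \<rho>_def norm_eq_rad indicator_def)

lemma \<rho>_integral: "integrable lebesgue \<rho>" "(LINT x|lebesgue. \<rho> x) = M"
proof -
  show "integrable lebesgue \<rho>"
    by (rule integrable_lebesgue_bounded_on(1)[where B = a and S = "ball 0 R"])
      (use a_pos ball_finite in \<open>auto simp: \<rho>_def indicator_def\<close>)
  have "(LINT x|lebesgue. \<rho> x) = (LINT x|lborel. \<rho> x)"
    by (rule integral_completion) measurable
  then show "(LINT x|lebesgue. \<rho> x) = M"
    using mass by (simp add: \<rho>_def)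
qed

lemma cyl_mass_\<rho>: "cyl_mass \<rho> r = a * measure lborel ({x. rad x < r} \<inter> ball 0 R)"
  unfolding \<rho>_def by (rule cyl_mass_indicator) simp

lemma fmeasurable_cylinder: "{x. rad x < r} \<inter> ball 0 R \<in> fmeasurable lborel"
proof (rule fmeasurableI2)
  show "ball (0::real^3) R \<in> fmeasurable lborel" using ball_finite by (auto simp: fmeasurable_def)
qed auto

lemma cyl_mass_in: "cyl_mass \<rho> r \<in> {0..M}"
proof -
  have "measure lborel ({x. rad x < r} \<inter> ball 0 R) \<le> measure lborel (ball (0::real^3) R)"
    using ball_finite by (intro measure_mono_fmeasurable) (auto simp: fmeasurable_def)
  then show ?thesis
    using mass a_pos unfolding cyl_mass_\<rho> by (auto simp flip: mass)
qed

text \<open>Gives Borel measurability of \<open>cyl_mass \<rho>\<close>, which the rotational term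
  needs.\<close>

lemma mono_cyl_mass: "mono (cyl_mass \<rho>)"
proof (rule monoI)
  fix r s :: real assume "r \<le> s"
  then have "measure lborel ({x. rad x < r} \<inter> ball 0 R) \<le> measure lborel ({x. rad x < s} \<inter> ball 0 R)"
    by (intro measure_mono_fmeasurable fmeasurable_cylinder) auto
  then show "cyl_mass \<rho> r \<le> cyl_mass \<rho> s"
    using a_pos by (simp add: cyl_mass_\<rho>)
qed

context
  fixes L :: "real \<Rightarrow> real" and C :: real
  assumes L_cont: "continuous_on {0..M} L"
    and L_nonneg: "\<And>m. m \<in> {0..M} \<Longrightarrow> L m \<ge> 0"
    and L_le: "\<And>m. m \<in> {0..M} \<Longrightarrow> L m \<le> C * m"
    and C: "C > 0"
begin

lemma measurable_rotation [measurable]: "(\<lambda>x. \<rho> x * L (cyl_mass \<rho> (rad x)) / (rad x)\<^sup>2) \<in> borel_measurable borel"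
proof -
  \<comment> \<open>\<open>L\<close> is controlled on \<open>{0..M}\<close> only. Clamping its
    argument gives a continuous function on the line, and changes nothing at the values of
    \<open>cyl_mass \<rho>\<close>, which lie in \<open>{0..M}\<close>.\<close>
  have "continuous_on UNIV (\<lambda>m. L (max 0 (min M m)))"
    by (rule continuous_on_compose2[OF L_cont]) (use M in \<open>auto intro!: continuous_intros\<close>)
  then have [measurable]: "(\<lambda>m. L (max 0 (min M m))) \<in> borel_measurable borel"
    by (rule borel_measurable_continuous_onI)
  have [measurable]: "cyl_mass \<rho> \<in> borel_measurable borel"
    using mono_cyl_mass by (rule borel_measurable_mono)
  have "L (cyl_mass \<rho> r) = L (max 0 (min M (cyl_mass \<rho> r)))" for r
    using cyl_mass_in[of r] by (simp add: max_absorb2 min_absorb2)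
  then show ?thesis by simp
qed

text \<open>The linear bound on \<open>L\<close> and the box bound on the cylinder give L(m(r))/r^2
  \<le> C * m(r)/r^2 \<le> 8 * C * a * R, so the density stays bounded up to the axis.\<close>

lemma rotation_bounds:
  "0 \<le> \<rho> x * L (cyl_mass \<rho> (rad x)) / (rad x)\<^sup>2"
  "\<rho> x * L (cyl_mass \<rho> (rad x)) / (rad x)\<^sup>2 \<le> (8 * C * a\<^sup>2 * R) * indicator (ball 0 R) x"
proof -
  let ?r = "rad x"
  show "0 \<le> \<rho> x * L (cyl_mass \<rho> ?r) / ?r\<^sup>2"
    using L_nonneg[OF cyl_mass_in] a_pos by (simp add: \<rho>_def)
  have "?r \<ge> 0" by (simp add: rad_def)
  have "L (cyl_mass \<rho> ?r) \<le> C * cyl_mass \<rho> ?r" by (rule L_le[OF cyl_mass_in])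
  also have "\<dots> \<le> C * (a * (8 * ?r\<^sup>2 * R))"
    unfolding cyl_mass_\<rho> using C a_pos R measure_cylinder_Int_ball_le[OF \<open>?r \<ge> 0\<close>, of R] by simp
  \<comment> \<open>On the axis the quotient is 0 by convention and the right side is
    positive.\<close>
  finally have "L (cyl_mass \<rho> ?r) / ?r\<^sup>2 \<le> 8 * C * a * R"
    using C a_pos R by (cases "?r = 0") (auto simp: field_simps)
  then have "a * (L (cyl_mass \<rho> ?r) / ?r\<^sup>2) \<le> a * (8 * C * a * R)"
    using a_pos by (intro mult_left_mono) auto
  then show "\<rho> x * L (cyl_mass \<rho> ?r) / ?r\<^sup>2 \<le> (8 * C * a\<^sup>2 * R) * indicator (ball 0 R) x"
    by (auto simp: \<rho>_def indicator_def power2_eq_square mult_ac)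
qed

lemma rotation_integral:
  "integrable lebesgue (\<lambda>x. \<rho> x * L (cyl_mass \<rho> (rad x)) / (rad x)\<^sup>2)"
  "(LINT x|lebesgue. \<rho> x * L (cyl_mass \<rho> (rad x)) / (rad x)\<^sup>2) \<le> 8 * C * a * R * M"
proof -
  have b: "\<bar>\<rho> x * L (cyl_mass \<rho> (rad x)) / (rad x)\<^sup>2\<bar> \<le> (8 * C * a\<^sup>2 * R) * indicator (ball 0 R) x" for x
    using rotation_bounds[of x] by linarith
  note * = integrable_lebesgue_bounded_on[OF measurable_rotation _ ball_finite b]
  show "integrable lebesgue (\<lambda>x. \<rho> x * L (cyl_mass \<rho> (rad x)) / (rad x)\<^sup>2)"
    by (rule *(1)) simp
  show "(LINT x|lebesgue. \<rho> x * L (cyl_mass \<rho> (rad x)) / (rad x)\<^sup>2) \<le> 8 * C * a * R * M"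
  proof -
    have "(LINT x|lebesgue. \<rho> x * L (cyl_mass \<rho> (rad x)) / (rad x)\<^sup>2)
        \<le> 8 * C * a\<^sup>2 * R * measure lborel (ball (0::real^3) R)"
      using *(2) by simp
    \<comment> \<open>One factor \<open>a\<close> times the volume is the total mass; the remaining
      a * R is of order 1/R^2.\<close>
    also have "\<dots> = 8 * C * a * R * (a * measure lborel (ball (0::real^3) R))"
      by (simp add: power2_eq_square)
    finally show ?thesis by (simp only: mass)
  qed
qed

end

text \<open>Two points of the ball are at distance at most 2R, so the potential is at least M/(2R)
  throughout the ball; integrating against mass M gives the bound.\<close>

lemma potential_integral:
  "integrable lebesgue (\<lambda>x. \<rho> x * newton_pot \<rho> x)"
  "(LINT x|lebesgue. \<rho> x * newton_pot \<rho> x) \<ge> M\<^sup>2 / (2 * R)"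
proof -
  have [measurable]: "newton_pot \<rho> \<in> borel_measurable borel"
    by (rule borel_measurable_newton_pot) measurable
  have ge: "a * M / (2 * R) * indicator (ball 0 R) x \<le> \<rho> x * newton_pot \<rho> x" for x
  proof (cases "x \<in> ball 0 R")
    case True
    have "dist x y \<le> 2 * R" if "y \<in> ball 0 R" for y
      using True that dist_triangle[of x y 0] by (simp add: dist_commute)
    then have "a * measure lborel (ball (0::real^3) R) / (2 * R) \<le> newton_pot \<rho> x"
      unfolding \<rho>_def using R a_pos ball_finite by (intro newton_pot_indicator_ge) auto
    then have "a * (M / (2 * R)) \<le> a * newton_pot \<rho> x"
      using a_pos mass by (intro mult_left_mono) auto
    then show ?thesis using True by (simp add: \<rho>_def)
  qed (simp add: \<rho>_def)
  \<comment> \<open>\<open>B\<close> only witnesses boundedness, for integrability; the energy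
    estimate uses the lower bound \<open>ge\<close>.\<close>
  define B where "B = a * (a * (measure lborel (ball (0::real^3) R) + 8/3 * unit_ball_vol 3))"
  have "\<bar>\<rho> x * newton_pot \<rho> x\<bar> \<le> B * indicator (ball 0 R) x" for x
    using newton_pot_indicator_nonneg[of a "ball 0 R" x] a_pos
      newton_pot_indicator_le[of "ball 0 R" a x] ball_finite
    unfolding B_def by (auto simp: \<rho>_def indicator_def)
  then show int: "integrable lebesgue (\<lambda>x. \<rho> x * newton_pot \<rho> x)"
    using ball_finite by (intro integrable_lebesgue_bounded_on(1)[where S = "ball 0 R"]) auto
  have i2: "integrable lebesgue (\<lambda>x::real^3. a * M / (2 * R) * indicator (ball 0 R) x)"
    using ball_finite a_pos R M
    by (intro integrable_lebesgue_bounded_on(1)[where S = "ball 0 R" and B = "a * M / (2 * R)"])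
      (auto intro!: borel_measurable_times borel_measurable_indicator borel_measurable_divide)
  have "M\<^sup>2 / (2 * R) = M / (2 * R) * (a * measure lborel (ball (0::real^3) R))"
    unfolding mass by (simp add: power2_eq_square)
  also have "\<dots> = a * M / (2 * R) * measure lborel (ball (0::real^3) R)"
    by simp
  also have "\<dots> = (LINT x|lebesgue. a * M / (2 * R) * indicator (ball (0::real^3) R) x)"
    by (subst integral_completion) auto
  also have "\<dots> \<le> (LINT x|lebesgue. \<rho> x * newton_pot \<rho> x)"
    by (intro integral_mono i2 int ge)
  finally show "(LINT x|lebesgue. \<rho> x * newton_pot \<rho> x) \<ge> M\<^sup>2 / (2 * R)" .
qed

lemma A_integral:
  "integrable lebesgue (\<lambda>x. A_fun p (\<rho> x))"
  "(LINT x|lebesgue. A_fun p (\<rho> x)) = M * (LINT s:{0<..a}|lborel. p s / s\<^sup>2)"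
proof -
  have eq: "A_fun p (\<rho> x) = A_fun p a * indicator (ball 0 R) x" for x
    by (simp add: \<rho>_def A_fun_indicator)
  show "integrable lebesgue (\<lambda>x. A_fun p (\<rho> x))"
    unfolding eq using ball_finite
    by (intro integrable_lebesgue_bounded_on(1)[where S = "ball 0 R" and B = "\<bar>A_fun p a\<bar>"])
      (auto simp: indicator_def intro!: borel_measurable_times borel_measurable_indicator)
  have "(LINT x|lebesgue. A_fun p (\<rho> x)) = A_fun p a * measure lborel (ball (0::real^3) R)"
    unfolding eq by (subst integral_completion) auto
  then show "(LINT x|lebesgue. A_fun p (\<rho> x)) = M * (LINT s:{0<..a}|lborel. p s / s\<^sup>2)"
    by (subst mass[symmetric]) (simp add: A_fun_def mult_ac)
qed

text \<open>Reduces the theorem to an estimate in \<open>R\<close> alone, once the pressure integral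
  is bounded by a power of \<open>a\<close>. The factors 1/2 in \<open>F\<close> turn 8 into 4 and
  M^2/(2R) into M^2/(4R).\<close>

lemma energy:
  assumes "continuous_on {0..M} L" "\<And>m. m \<in> {0..M} \<Longrightarrow> L m \<ge> 0"
    "\<And>m. m \<in> {0..M} \<Longrightarrow> L m \<le> C * m" "C > 0"
  shows "\<rho> \<in> W p L M"
    and "F p L \<rho> \<le> M * (LINT s:{0<..a}|lborel. p s / s\<^sup>2) + 4 * C * a * R * M - M\<^sup>2 / (4 * R)"
proof -
  note rot = rotation_integral[OF assms]
  note int = A_integral(1)[of p] rot(1) potential_integral(1)
  show "\<rho> \<in> W p L M"
    unfolding W_def using axisymmetric_\<rho> \<rho>_integral a_pos int by (auto simp: \<rho>_def)
  have "F p L \<rho> = (LINT x|lebesgue. A_fun p (\<rho> x))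
      + 1/2 * (LINT x|lebesgue. \<rho> x * L (cyl_mass \<rho> (rad x)) / (rad x)\<^sup>2)
      - 1/2 * (LINT x|lebesgue. \<rho> x * newton_pot \<rho> x)"
    unfolding F_def
    by (simp only: Bochner_Integration.integral_diff Bochner_Integration.integral_add
        Bochner_Integration.integrable_add integrable_mult_right int integral_mult_right_zero)
  then show "F p L \<rho> \<le> M * (LINT s:{0<..a}|lborel. p s / s\<^sup>2) + 4 * C * a * R * M - M\<^sup>2 / (4 * R)"
    using rot(2) potential_integral(2) A_integral(2)[of p] by simp
qed

end

section \<open>Small densities, large radii, and the conclusion\<close>

text \<open>Near 0 the limit gives p(s) \<le> (\<beta> + 1) * s^\<gamma>, and s^(\<gamma> - 2) is
  integrable at 0 because \<gamma> > 1. This \<gamma> is the exponent at zero density,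
  \<open>\<gamma>\<^sub>1\<close> in the theorem.\<close>

lemma set_integral_pressure_le:
  fixes p :: "real \<Rightarrow> real" and \<beta> \<gamma> :: real
  assumes int: "set_integrable lborel {0<..1} (\<lambda>s. p s / s\<^sup>2)"
    and lim: "((\<lambda>s. p s / s powr \<gamma>) \<longlongrightarrow> \<beta>) (at_right 0)" and \<gamma>: "\<gamma> > 1"
  obtains D \<delta> where "\<delta> > 0"
    "\<And>a. 0 < a \<Longrightarrow> a < \<delta> \<Longrightarrow> (LINT s:{0<..a}|lborel. p s / s\<^sup>2) \<le> D * a powr (\<gamma> - 1)"
proof -
  have "eventually (\<lambda>s. p s / s powr \<gamma> < \<beta> + 1) (at_right 0)"
    using lim by (rule order_tendstoD(2)) simp
  then obtain d where d: "d > 0" "\<And>s. 0 < s \<Longrightarrow> s < d \<Longrightarrow> p s / s powr \<gamma> < \<beta> + 1"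
    unfolding eventually_at_right_field by auto
  have "(LINT s:{0<..a}|lborel. p s / s\<^sup>2) \<le> ((\<beta> + 1) / (\<gamma> - 1)) * a powr (\<gamma> - 1)"
    \<comment> \<open>Below \<open>d\<close> the pointwise bound on \<open>p\<close> holds; below 1
      the interval stays inside \<open>{0<..1}\<close>, where integrability is assumed.\<close>
    if a: "0 < a" "a < min d 1" for a
  proof -
    let ?f = "\<lambda>s. (\<beta> + 1) * s powr (\<gamma> - 2)"
    have "(?f has_integral ((\<beta> + 1) * (a powr (\<gamma> - 2 + 1) / (\<gamma> - 2 + 1)))) {0..a}"
      using a \<gamma> by (intro has_integral_mult_right has_integral_powr_from_0) auto
    then have "(?f has_integral ((\<beta> + 1) / (\<gamma> - 1) * a powr (\<gamma> - 1))) {0..a}"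
      by simp
    moreover have "(?f has_integral y) {0..a} \<longleftrightarrow> (?f has_integral y) {0<..a}" for y
    proof (rule has_integral_spike_set_eq)
      show "negligible {x \<in> {0..a} - {0<..a}. ?f x \<noteq> 0}"
        by (rule negligible_subset[of "{0}"]) auto
      show "negligible {x \<in> {0<..a} - {0..a}. ?f x \<noteq> 0}"
        by (rule negligible_subset[of "{0}"]) auto
    qed
    ultimately have bound: "(?f has_integral ((\<beta> + 1) / (\<gamma> - 1) * a powr (\<gamma> - 1))) {0<..a}"
      by blast
    have ip: "set_integrable lborel {0<..a} (\<lambda>s. p s / s\<^sup>2)"
      by (rule set_integrable_subset[OF int]) (use a in auto)
    note hp = set_borel_integral_eq_integral[OF ip]
    have "(LINT s:{0<..a}|lborel. p s / s\<^sup>2) = integral {0<..a} (\<lambda>s. p s / s\<^sup>2)" by (rule hp)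
    also have "\<dots> \<le> (\<beta> + 1) / (\<gamma> - 1) * a powr (\<gamma> - 1)"
    proof (rule has_integral_le[OF integrable_integral[OF hp(1)] bound])
      fix s assume s: "s \<in> {0<..a}"
      then have "p s \<le> (\<beta> + 1) * s powr \<gamma>"
        using d(2)[of s] a by (simp add: field_simps)
      then show "p s / s\<^sup>2 \<le> (\<beta> + 1) * s powr (\<gamma> - 2)"
        using s by (simp add: powr_diff divide_right_mono)
    qed
    finally show ?thesis .
  qed
  with d(1) show thesis by (intro that[of "min d 1" "(\<beta> + 1) / (\<gamma> - 1)"]) auto
qed

text \<open>After multiplication by R the gravitational term is the constant -M^2/4, while the
  internal term is of order R^(1 - 3q) and the rotational one of order 1/R; both vanish as R grows,
  since q > 1/3. With q = \<open>\<gamma>\<^sub>1 - 1\<close> this is the condition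
  \<open>\<gamma>\<^sub>1 > 4/3\<close>.\<close>

lemma uniform_ball_energy_bound_negative:
  fixes M V C D \<delta> q :: real
  assumes "M > 0" "V > 0" "\<delta> > 0" "q > 1/3"
  obtains R a where "R > 0" "a = M / (V * R ^ 3)" "a < \<delta>"
    "M * (D * a powr q) + 4 * C * a * R * M - M\<^sup>2 / (4 * R) < 0"
proof -
  define a where "a R = M / (V * R ^ 3)" for R
  have "eventually (\<lambda>R. a R < \<delta>) at_top"
  proof -
    have "(a \<longlongrightarrow> 0) at_top"
      unfolding a_def using assms
      by (intro tendsto_divide_0[OF tendsto_const] filterlim_at_top_imp_at_infinity
          filterlim_tendsto_pos_mult_at_top[OF tendsto_const] filterlim_pow_at_top filterlim_ident) auto
    then show ?thesis using assms by (intro order_tendstoD(2)) auto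
  qed
  moreover have "eventually (\<lambda>R. M * (D * a R powr q) + 4 * C * a R * R * M - M\<^sup>2 / (4 * R) < 0) at_top"
  proof -
    have "((\<lambda>R. M * D * (M / V) powr q * R powr (1 - 3 * q) + 4 * C * (M / V) * M / R) \<longlongrightarrow> M * D * (M / V) powr q * 0 + 0) at_top"
    proof (rule tendsto_add)
      show "((\<lambda>R. M * D * (M / V) powr q * R powr (1 - 3 * q)) \<longlongrightarrow> M * D * (M / V) powr q * 0) at_top"
        by (rule tendsto_mult_left, rule tendsto_neg_powr) (use assms in \<open>simp_all add: filterlim_ident\<close>)
      show "((\<lambda>R. 4 * C * (M / V) * M / R) \<longlongrightarrow> 0) at_top"
        by (rule tendsto_divide_0[OF tendsto_const], rule filterlim_at_top_imp_at_infinity, rule filterlim_ident)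
    qed
    then have "eventually (\<lambda>R. M * D * (M / V) powr q * R powr (1 - 3 * q) + 4 * C * (M / V) * M / R < M\<^sup>2 / 4) at_top"
      by (rule order_tendstoD) (use assms in simp)
    then show ?thesis using eventually_gt_at_top[of 0]
    proof eventually_elim
      case (elim R)
      have "a R powr q = (M / V) powr q * R powr (- 3 * q)"
      proof -
        have "a R = (M / V) * R powr (- 3)"
          using elim assms by (simp add: a_def powr_minus powr_numeral field_simps)
        also have "\<dots> powr q = (M / V) powr q * (R powr (- 3)) powr q"
          by (rule powr_mult)
        finally show ?thesis by (simp add: powr_powr)
      qed
      moreover have "R powr (1 - 3 * q) = R * R powr (- 3 * q)"
        using elim powr_add[of R 1 "- 3 * q"] by simp
      moreover have "R * (4 * C * a R * R * M) = 4 * C * (M / V) * M / R"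
        using elim by (simp add: a_def power3_eq_cube)
      moreover have "R * (M\<^sup>2 / (4 * R)) = M\<^sup>2 / 4"
        using elim by simp
      ultimately have "R * (M * (D * a R powr q) + 4 * C * a R * R * M - M\<^sup>2 / (4 * R))
          = M * D * (M / V) powr q * R powr (1 - 3 * q) + 4 * C * (M / V) * M / R - M\<^sup>2 / 4"
        by (simp only: distrib_left right_diff_distrib mult_ac)
      also have "\<dots> < 0" using elim by simp
      finally show ?case using elim by (simp add: mult_less_0_iff)
    qed
  qed
  ultimately have "eventually (\<lambda>R. R > 0 \<and> a R < \<delta> \<and> 
      M * (D * a R powr q) + 4 * C * a R * R * M - M\<^sup>2 / (4 * R) < 0) at_top"
    using eventually_gt_at_top[of 0] by eventually_elim auto
  then obtain R where "R > 0 \<and> a R < \<delta> \<and> 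
      M * (D * a R powr q) + 4 * C * a R * R * M - M\<^sup>2 / (4 * R) < 0"
    using eventually_happens'[OF trivial_limit_at_top_linorder] by blast
  then show thesis by (intro that[of R "a R"]) (auto simp: a_def)
qed

theorem theorem4p2:
  fixes p :: "real \<Rightarrow> real" and K \<gamma> \<gamma>\<^sub>1 \<beta> :: real
  assumes "C1_on {0..} p"
    and "set_integrable lborel {0<..1} (\<lambda>s. p s / s\<^sup>2)"
    and "((\<lambda>s. p s / s powr \<gamma>) \<longlongrightarrow> K) at_top"
    and "\<And>s. s \<ge> 0 \<Longrightarrow> p s \<ge> 0"
    and "\<And>s. s > 0 \<Longrightarrow> deriv p s > 0"
    and "K > 0" and "\<gamma> \<ge> 4/3"
    and "((\<lambda>s. p s / s powr \<gamma>\<^sub>1) \<longlongrightarrow> \<beta>) (at_right 0)"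
    and "\<gamma>\<^sub>1 > 4/3" and "\<beta> > 0"
  shows "\<exists>M\<^sub>c :: ereal.
           (\<gamma> = 4/3 \<longrightarrow> 0 < M\<^sub>c \<and> M\<^sub>c < \<infinity>) \<and>
           (\<gamma> > 4/3 \<longrightarrow> M\<^sub>c = \<infinity>) \<and>
           (\<forall>(M :: real) (L :: real \<Rightarrow> real).
              0 < M \<and> ereal M < M\<^sub>c \<and> C1_on {0..M} L \<and> L 0 = 0 \<and> (\<forall>m\<in>{0..M}. L m \<ge> 0)
              \<longrightarrow> (INF \<rho>\<in>W p L M. ereal (F p L \<rho>)) < 0)"
proof -
  have g1: "\<gamma>\<^sub>1 > 1" using assms(9) by simp
  obtain D \<delta> where \<delta>: "\<delta> > 0"
    and D: "\<And>a. 0 < a \<Longrightarrow> a < \<delta> \<Longrightarrow> (LINT s:{0<..a}|lborel. p s / s\<^sup>2) \<le> D * a powr (\<gamma>\<^sub>1 - 1)"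
    using set_integral_pressure_le[OF assms(2,8)] g1 by blast
  \<comment> \<open>\<open>D\<close> and \<delta> depend on the pressure law alone, but
    \<open>C\<close> depends on \<open>L\<close>, so the radius is chosen only after
    \<open>M\<close> and \<open>L\<close> are fixed.\<close>
  have neg: "(INF \<rho>\<in>W p L M. ereal (F p L \<rho>)) < 0"
    if M: "M > 0" and L: "C1_on {0..M} L" "L 0 = 0" "\<forall>m\<in>{0..M}. L m \<ge> 0" for M L
  proof -
    obtain C where C: "C > 0" "\<And>m. m \<in> {0..M} \<Longrightarrow> L m \<le> C * m"
      using C1_on_linear_bound[OF L(1,2)] by blast
    have contL: "continuous_on {0..M} L"
      using L(1) unfolding C1_on_def by (auto intro: DERIV_continuous_on)
    obtain R a where R: "R > 0" and a: "a = M / (unit_ball_vol 3 * R ^ 3)" "a < \<delta>"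
      and *: "M * (D * a powr (\<gamma>\<^sub>1 - 1)) + 4 * C * a * R * M - M\<^sup>2 / (4 * R) < 0"
      using uniform_ball_energy_bound_negative[of M "unit_ball_vol 3" \<delta> "\<gamma>\<^sub>1 - 1" D C] M \<delta> assms(9) by auto
    interpret uniform_ball R M a by unfold_locales (fact R M a(1))+
    note E = energy[OF contL _ C(2,1), of p]
    have mem: "\<rho> \<in> W p L M" using E(1) L(3) by auto
    have "F p L \<rho> \<le> M * (LINT s:{0<..a}|lborel. p s / s\<^sup>2) + 4 * C * a * R * M - M\<^sup>2 / (4 * R)"
      using E(2) L(3) by auto
    also have "\<dots> \<le> M * (D * a powr (\<gamma>\<^sub>1 - 1)) + 4 * C * a * R * M - M\<^sup>2 / (4 * R)"
      using D[OF a_pos a(2)] M by simp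
    also have "\<dots> < 0" by (rule *)
    finally have "ereal (F p L \<rho>) < 0" by simp
    with mem show ?thesis by (meson INF_lower order_le_less_trans)
  qed
  \<comment> \<open>The energy is negative for every mass, so the value 1 is an arbitrary choice.\<close>
  show ?thesis
    by (rule exI[of _ "if \<gamma> = 4/3 then 1 else \<infinity>"]) (use neg in auto)
qed

end
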